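(* Let $\mathcal V=(\Lambda,\mathbf F,\omega)$ and $\mathcal W=(\Gamma,\mathbf G,\nu)$ be Bessel continuous generalized fusion mappings for $\mathcal H$ with Bessel bounds $B_1$ and $B_2$ respectively, and let $S_{\mathbf{FG},\Lambda\Gamma}f=\int_X\omega(x)\nu(x)\pi_{F(x)}\Lambda_x^*\Gamma_x\pi_{G(x)}f\,d\mu(x)$, $f\in\mathcal H$. The following assertions are equivalent: (i) $S_{\mathbf{FG},\Lambda\Gamma}$ is bounded below; (ii) there exists a bounded linear operator $K$ on $\mathcal H$ such that $\{T_x\}_{x\in X}$ is a resolution of the identity, where $T_x=\omega(x)\nu(x)K\pi_{F(x)}\Lambda_x^*\Gamma_x\pi_{G(x)}$, $x\in X$. If one of these conditions is satisfied, then $\mathcal W$ is a continuous generalized fusion frame for $\mathcal H$.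
   Context: $\mathcal H$ is a Hilbert space; $\pi_V$ is the orthogonal projection of $\mathcal H$ onto a closed subspace $V$. $(X,\mu)$ is a measure space and $\omega,\nu:X\to[0,\infty)$ are measurable and nonzero a.e. $\mathbf F,\mathbf G$ assign to each $x\in X$ closed subspaces $F(x),G(x)\subseteq\mathcal H$ such that $x\mapsto\pi_{F(x)}f$ and $x\mapsto\pi_{G(x)}f$ are weakly measurable for each $f$. $\{\mathcal H_x\}_{x\in X}$ are Hilbert spaces, $\Lambda=\{\Lambda_x\}$, $\Gamma=\{\Gamma_x\}$ with $\Lambda_x:F(x)\to\mathcal H_x$, $\Gamma_x:G(x)\to\mathcal H_x$ bounded linear. All scalar integrands occurring (including $x\mapsto\langle\Gamma_x\pi_{G(x)}f,\Lambda_x\pi_{F(x)}g\rangle$) are assumed measurable and vector-valued integrals are understood weakly. $(\Lambda,\mathbf F,\omega)$ is a Bessel continuous generalized fusion mapping with Bessel bound $B_1\in(0,\infty)$ if $\int_X\omega^2(x)\|\Lambda_x\pi_{F(x)}f\|^2d\mu(x)\le B_1\|f\|^2$ for all $f\in\mathcal H$, and a continuous generalized fusion frame if moreover $A\|f\|^2\le\int_X\omega^2(x)\|\Lambda_x\pi_{F(x)}f\|^2d\mu(x)$ for some $A>0$ and all $f$; similarly for $(\Gamma,\mathbf G,\nu)$ with weight $\nu$. An operator $S$ is bounded below if $\|Sf\|\ge c\|f\|$ for some $c>0$ and all $f\in\mathcal H$. A family $\{T_x\}_{x\in X}$ of bounded operators on $\mathcal H$ is a resolution of the identity if $f=\int_XT_xf\,d\mu(x)$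 weakly for all $f\in\mathcal H$, i.e. $\langle f,g\rangle=\int_X\langle T_xf,g\rangle d\mu(x)$ for all $f,g\in\mathcal H$. *)

theory Defs
  imports "HOL-Analysis.Analysis"
begin

(* The scalar field, treated uniformly for real and complex Hilbert spaces.  The axioms force
   z + sconj z to be real, so every model is a copy of the reals or of the complex numbers. *)
class hilbert_scalar = real_normed_field + banach + second_countable_topology +
  fixes sconj :: "'a \<Rightarrow> 'a"
  assumes sconj_add: "sconj (a + b) = sconj a + sconj b"
    and sconj_mult: "sconj (a * b) = sconj a * sconj b"
    and sconj_sconj: "sconj (sconj a) = a"
    and sconj_scaleR: "sconj (r *\<^sub>R a) = r *\<^sub>R sconj a"
    and mult_sconj: "a * sconj a = (norm a)\<^sup>2 *\<^sub>R 1"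

instantiation real :: hilbert_scalar
begin
definition sconj_real :: "real \<Rightarrow> real" where "sconj_real r = r"
instance by standard (simp_all add: sconj_real_def power2_eq_square)
end

instantiation complex :: hilbert_scalar
begin
definition sconj_complex :: "complex \<Rightarrow> complex" where "sconj_complex z = cnj z"
instance by standard (simp_all add: sconj_complex_def complex_norm_square [symmetric] scaleR_conv_of_real del: of_real_power)
end

(* The ambient Hilbert space is a type; completeness comes from the sort banach, whose norm
   is required to be the one induced by the inner product.  Inner products are linear in the
   first argument. *)
locale hilbert_space = vector_space smul
  for smul :: "'s::hilbert_scalar \<Rightarrow> 'h::banach \<Rightarrow> 'h" +
  fixes ip :: "'h \<Rightarrow> 'h \<Rightarrow> 's"
  assumes scale_of_real: "smul (of_real r) f = r *\<^sub>R f"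
    and ip_add: "ip (f + g) h = ip f h + ip g h"
    and ip_scale: "ip (smul c f) g = c * ip f g"
    and ip_commute: "ip g f = sconj (ip f g)"
    and ip_norm: "ip f f = of_real ((norm f)\<^sup>2)"

(* The spaces H_x may differ from point to point, so each is a structure with its own carrier
   and operations inside a common type. *)
record ('s, 'k) hilbert_struct =
  h_carrier :: "'k set"
  h_add :: "'k \<Rightarrow> 'k \<Rightarrow> 'k"
  h_zero :: 'k
  h_scale :: "'s \<Rightarrow> 'k \<Rightarrow> 'k"
  h_ip :: "'k \<Rightarrow> 'k \<Rightarrow> 's"

definition h_norm :: "('s::hilbert_scalar, 'k) hilbert_struct \<Rightarrow> 'k \<Rightarrow> real" where
  "h_norm H u = sqrt (norm (h_ip H u u))"

definition h_dist :: "('s::hilbert_scalar, 'k) hilbert_struct \<Rightarrow> 'k \<Rightarrow> 'k \<Rightarrow> real" where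
  "h_dist H u v = h_norm H (h_add H u (h_scale H (- 1) v))"

locale hilbert_space_on =
  fixes H :: "('s::hilbert_scalar, 'k) hilbert_struct"
  assumes add_closed: "\<lbrakk>u \<in> h_carrier H; v \<in> h_carrier H\<rbrakk> \<Longrightarrow> h_add H u v \<in> h_carrier H"
    and zero_closed: "h_zero H \<in> h_carrier H"
    and scale_closed: "u \<in> h_carrier H \<Longrightarrow> h_scale H c u \<in> h_carrier H"
    and add_assoc: "\<lbrakk>u \<in> h_carrier H; v \<in> h_carrier H; w \<in> h_carrier H\<rbrakk>
          \<Longrightarrow> h_add H (h_add H u v) w = h_add H u (h_add H v w)"
    and add_commute: "\<lbrakk>u \<in> h_carrier H; v \<in> h_carrier H\<rbrakk> \<Longrightarrow> h_add H u v = h_add H v u"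
    and add_zero: "u \<in> h_carrier H \<Longrightarrow> h_add H u (h_zero H) = u"
    and add_inverse: "u \<in> h_carrier H \<Longrightarrow> \<exists>v\<in>h_carrier H. h_add H u v = h_zero H"
    and scale_add: "\<lbrakk>u \<in> h_carrier H; v \<in> h_carrier H\<rbrakk>
          \<Longrightarrow> h_scale H c (h_add H u v) = h_add H (h_scale H c u) (h_scale H c v)"
    and add_scale: "u \<in> h_carrier H
          \<Longrightarrow> h_scale H (c + d) u = h_add H (h_scale H c u) (h_scale H d u)"
    and scale_scale: "u \<in> h_carrier H \<Longrightarrow> h_scale H c (h_scale H d u) = h_scale H (c * d) u"
    and scale_one: "u \<in> h_carrier H \<Longrightarrow> h_scale H 1 u = u"
    and ip_add: "\<lbrakk>u \<in> h_carrier H; v \<in> h_carrier H; w \<in> h_carrier H\<rbrakk>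
          \<Longrightarrow> h_ip H (h_add H u v) w = h_ip H u w + h_ip H v w"
    and ip_scale: "\<lbrakk>u \<in> h_carrier H; v \<in> h_carrier H\<rbrakk>
          \<Longrightarrow> h_ip H (h_scale H c u) v = c * h_ip H u v"
    and ip_commute: "\<lbrakk>u \<in> h_carrier H; v \<in> h_carrier H\<rbrakk> \<Longrightarrow> h_ip H v u = sconj (h_ip H u v)"
    and ip_nonneg: "u \<in> h_carrier H \<Longrightarrow> \<exists>r\<ge>0. h_ip H u u = of_real r"
    and ip_definite: "\<lbrakk>u \<in> h_carrier H; h_ip H u u = 0\<rbrakk> \<Longrightarrow> u = h_zero H"
    and complete: "\<lbrakk>\<And>n. s n \<in> h_carrier H;
          \<forall>e>0. \<exists>N::nat. \<forall>m\<ge>N. \<forall>n\<ge>N. h_dist H (s m) (s n) < e\<rbrakk>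
          \<Longrightarrow> \<exists>l\<in>h_carrier H. (\<lambda>n. h_dist H (s n) l) \<longlonglongrightarrow> 0"

definition orth_proj :: "('h::banach \<Rightarrow> 'h \<Rightarrow> 's::hilbert_scalar) \<Rightarrow> 'h set \<Rightarrow> 'h \<Rightarrow> 'h" where
  "orth_proj ip V f = (THE u. u \<in> V \<and> (\<forall>v\<in>V. ip (f - u) v = 0))"

definition bounded_op :: "('s::hilbert_scalar \<Rightarrow> 'h::banach \<Rightarrow> 'h) \<Rightarrow> ('h \<Rightarrow> 'h) \<Rightarrow> bool" where
  "bounded_op smul T \<longleftrightarrow>
     Vector_Spaces.linear smul smul T \<and> (\<exists>C. \<forall>f. norm (T f) \<le> C * norm f)"

(* L is a bounded linear map from the subspace V into H; its values off V are irrelevant. *)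
definition bounded_linear_into ::
    "('s::hilbert_scalar \<Rightarrow> 'h::banach \<Rightarrow> 'h) \<Rightarrow> 'h set \<Rightarrow> ('s, 'k) hilbert_struct
      \<Rightarrow> ('h \<Rightarrow> 'k) \<Rightarrow> bool" where
  "bounded_linear_into smul V H L \<longleftrightarrow>
     (\<forall>u\<in>V. L u \<in> h_carrier H) \<and>
     (\<forall>u\<in>V. \<forall>v\<in>V. L (u + v) = h_add H (L u) (L v)) \<and>
     (\<forall>c. \<forall>u\<in>V. L (smul c u) = h_scale H c (L u)) \<and>
     (\<exists>C. \<forall>u\<in>V. h_norm H (L u) \<le> C * norm u)"

(* The Hilbert space adjoint, from H to V, of L from V to H. *)
definition adjoint_into ::
    "('h::banach \<Rightarrow> 'h \<Rightarrow> 's::hilbert_scalar) \<Rightarrow> 'h set \<Rightarrow> ('s, 'k) hilbert_struct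
      \<Rightarrow> ('h \<Rightarrow> 'k) \<Rightarrow> 'k \<Rightarrow> 'h" where
  "adjoint_into ip V H L k = (THE u. u \<in> V \<and> (\<forall>v\<in>V. h_ip H (L v) k = ip v u))"

definition has_weak_integral ::
    "('h::banach \<Rightarrow> 'h \<Rightarrow> 's::hilbert_scalar) \<Rightarrow> 'x measure \<Rightarrow> ('x \<Rightarrow> 'h) \<Rightarrow> 'h \<Rightarrow> bool" where
  "has_weak_integral ip M u v \<longleftrightarrow>
     (\<forall>g. integrable M (\<lambda>x. ip (u x) g) \<and> ip v g = (LINT x|M. ip (u x) g))"

definition weak_integral ::
    "('h::banach \<Rightarrow> 'h \<Rightarrow> 's::hilbert_scalar) \<Rightarrow> 'x measure \<Rightarrow> ('x \<Rightarrow> 'h) \<Rightarrow> 'h" where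
  "weak_integral ip M u = (THE v. has_weak_integral ip M u v)"

(* The standing assumptions on a triple (L, F, w).  Measurability of the integrand of the
   Bessel and frame inequalities is included. *)
definition fusion_mapping ::
    "('s::hilbert_scalar \<Rightarrow> 'h::banach \<Rightarrow> 'h) \<Rightarrow> ('h \<Rightarrow> 'h \<Rightarrow> 's) \<Rightarrow> 'x measure
      \<Rightarrow> ('x \<Rightarrow> ('s, 'k) hilbert_struct) \<Rightarrow> ('x \<Rightarrow> 'h \<Rightarrow> 'k) \<Rightarrow> ('x \<Rightarrow> 'h set) \<Rightarrow> ('x \<Rightarrow> real) \<Rightarrow> bool"
  where
  "fusion_mapping smul ip M H L F w \<longleftrightarrow>
     w \<in> borel_measurable M \<and> (\<forall>x\<in>space M. 0 \<le> w x) \<and> (AE x in M. w x \<noteq> 0) \<and>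
     (\<forall>x\<in>space M. module.subspace smul (F x) \<and> closed (F x)) \<and>
     (\<forall>f g. (\<lambda>x. ip (orth_proj ip (F x) f) g) \<in> borel_measurable M) \<and>
     (\<forall>x\<in>space M. bounded_linear_into smul (F x) (H x) (L x)) \<and>
     (\<forall>f. (\<lambda>x. (w x)\<^sup>2 * (h_norm (H x) (L x (orth_proj ip (F x) f)))\<^sup>2) \<in> borel_measurable M)"

definition bessel_fusion_mapping ::
    "('s::hilbert_scalar \<Rightarrow> 'h::banach \<Rightarrow> 'h) \<Rightarrow> ('h \<Rightarrow> 'h \<Rightarrow> 's) \<Rightarrow> 'x measure
      \<Rightarrow> ('x \<Rightarrow> ('s, 'k) hilbert_struct) \<Rightarrow> ('x \<Rightarrow> 'h \<Rightarrow> 'k) \<Rightarrow> ('x \<Rightarrow> 'h set) \<Rightarrow> ('x \<Rightarrow> real)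
      \<Rightarrow> real \<Rightarrow> bool"
  where
  "bessel_fusion_mapping smul ip M H L F w B \<longleftrightarrow>
     fusion_mapping smul ip M H L F w \<and> 0 < B \<and>
     (\<forall>f. (\<integral>\<^sup>+x. ennreal ((w x)\<^sup>2 * (h_norm (H x) (L x (orth_proj ip (F x) f)))\<^sup>2) \<partial>M)
            \<le> ennreal (B * (norm f)\<^sup>2))"

definition fusion_frame ::
    "('s::hilbert_scalar \<Rightarrow> 'h::banach \<Rightarrow> 'h) \<Rightarrow> ('h \<Rightarrow> 'h \<Rightarrow> 's) \<Rightarrow> 'x measure
      \<Rightarrow> ('x \<Rightarrow> ('s, 'k) hilbert_struct) \<Rightarrow> ('x \<Rightarrow> 'h \<Rightarrow> 'k) \<Rightarrow> ('x \<Rightarrow> 'h set) \<Rightarrow> ('x \<Rightarrow> real) \<Rightarrow> bool"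
  where
  "fusion_frame smul ip M H L F w \<longleftrightarrow>
     (\<exists>B. bessel_fusion_mapping smul ip M H L F w B) \<and>
     (\<exists>A>0. \<forall>f. ennreal (A * (norm f)\<^sup>2)
        \<le> (\<integral>\<^sup>+x. ennreal ((w x)\<^sup>2 * (h_norm (H x) (L x (orth_proj ip (F x) f)))\<^sup>2) \<partial>M))"

(* At each x, the operator pi_F(x) L_x^* R_x pi_G(x). *)
definition mixed_op ::
    "('h::banach \<Rightarrow> 'h \<Rightarrow> 's::hilbert_scalar) \<Rightarrow> ('x \<Rightarrow> ('s, 'k) hilbert_struct)
      \<Rightarrow> ('x \<Rightarrow> 'h \<Rightarrow> 'k) \<Rightarrow> ('x \<Rightarrow> 'h set) \<Rightarrow> ('x \<Rightarrow> 'h \<Rightarrow> 'k) \<Rightarrow> ('x \<Rightarrow> 'h set) \<Rightarrow> 'x \<Rightarrow> 'h \<Rightarrow> 'h" where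
  "mixed_op ip H L F R G x f =
     orth_proj ip (F x) (adjoint_into ip (F x) (H x) (L x) (R x (orth_proj ip (G x) f)))"

definition mixed_frame_op ::
    "('h::banach \<Rightarrow> 'h \<Rightarrow> 's::hilbert_scalar) \<Rightarrow> 'x measure \<Rightarrow> ('x \<Rightarrow> ('s, 'k) hilbert_struct)
      \<Rightarrow> ('x \<Rightarrow> 'h \<Rightarrow> 'k) \<Rightarrow> ('x \<Rightarrow> 'h set) \<Rightarrow> ('x \<Rightarrow> real)
      \<Rightarrow> ('x \<Rightarrow> 'h \<Rightarrow> 'k) \<Rightarrow> ('x \<Rightarrow> 'h set) \<Rightarrow> ('x \<Rightarrow> real) \<Rightarrow> 'h \<Rightarrow> 'h" where
  "mixed_frame_op ip M H L F w R G v f =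
     weak_integral ip M (\<lambda>x. (w x * v x) *\<^sub>R mixed_op ip H L F R G x f)"

definition bounded_below :: "('h::banach \<Rightarrow> 'h) \<Rightarrow> bool" where
  "bounded_below S \<longleftrightarrow> (\<exists>c>0. \<forall>f. c * norm f \<le> norm (S f))"

definition resolution_of_identity ::
    "('s::hilbert_scalar \<Rightarrow> 'h::banach \<Rightarrow> 'h) \<Rightarrow> ('h \<Rightarrow> 'h \<Rightarrow> 's) \<Rightarrow> 'x measure
      \<Rightarrow> ('x \<Rightarrow> 'h \<Rightarrow> 'h) \<Rightarrow> bool" where
  "resolution_of_identity smul ip M T \<longleftrightarrow>
     (\<forall>x\<in>space M. bounded_op smul (T x)) \<and> (\<forall>f. has_weak_integral ip M (\<lambda>x. T x f) f)"

end

theory Submission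
  imports Defs
begin

text \<open>The Bessel bounds and Cauchy--Schwarz make the mixed form bounded, so by the Riesz
  representation the weak integrals defining \<open>S\<close> exist. An operator \<open>K\<close> can be moved under the weak
  integral through its adjoint, so \<open>T\<close> resolves the identity exactly when \<open>K S = I\<close>. A bounded left
  inverse of \<open>S\<close> exists exactly when \<open>S\<close> is bounded below: its range is then closed, and \<open>K\<close> is
  the projection onto the range followed by the inverse of \<open>S\<close>. Finally Cauchy--Schwarz for the
  form turns \<open>c \<parallel>f\<parallel> \<le> \<parallel>S f\<parallel>\<close> into the lower frame bound \<open>c\<^sup>2 / B\<^sub>1\<close> of the second mapping.\<close>

section \<open>Conjugation on the scalar field\<close>

lemma sconj_zero: "sconj (0::'a::hilbert_scalar) = 0"
  using sconj_scaleR[of 0 "0::'a"] by simp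

lemma sconj_minus: "sconj (- a) = - sconj (a::'a::hilbert_scalar)"
  using sconj_scaleR[of "-1" a] by simp

lemma sconj_of_real: "sconj (of_real r) = (of_real r :: 'a::hilbert_scalar)"
proof -
  have "sconj 1 = (1::'a)"
    using mult_sconj[of "1::'a"] by simp
  then show ?thesis
    by (simp add: of_real_def sconj_scaleR)
qed

lemma norm_sconj: "norm (sconj a) = norm (a::'a::hilbert_scalar)"
proof (cases "a = 0")
  case False
  have "norm a * norm (sconj a) = (norm a)\<^sup>2"
    using arg_cong[OF mult_sconj[of a], of norm] by (simp add: norm_mult)
  with False show ?thesis
    by (simp add: power2_eq_square)
qed (simp add: sconj_zero)

text \<open>Lets conjugation pass through Bochner integrals and preserve measurability, so the two
  orders of arguments of \<open>ip\<close> under an integral can be exchanged.\<close>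

lemma bounded_linear_sconj: "bounded_linear (sconj :: 'a::hilbert_scalar \<Rightarrow> 'a)"
  by (rule bounded_linear_intro[where K = 1]) (simp_all add: sconj_add sconj_scaleR norm_sconj)

lemma mult_sconj_of_real: "a * sconj a = of_real ((norm a)\<^sup>2)" for a :: "'a::hilbert_scalar"
  by (simp add: mult_sconj of_real_def)

text \<open>The squared norm of \<open>u - c v\<close>, where \<open>c = \<langle>u, v\<rangle> / D\<close>, \<open>A = \<langle>u, u\<rangle>\<close> and \<open>D = \<langle>v, v\<rangle>\<close>.\<close>

lemma residual_square:
  fixes b c :: "'a::hilbert_scalar"
  assumes "D \<noteq> 0" and c: "c = b / of_real D"
    and R: "of_real R = of_real A - sconj c * b - c * sconj b + c * sconj c * of_real D"
  shows "R = A - (norm b)\<^sup>2 / D"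
proof -
  have "sconj c = sconj b / of_real D"
  proof -
    have "sconj b = sconj (c * of_real D)"
      using assms by simp
    then show ?thesis
      using assms(1) by (simp add: sconj_mult sconj_of_real)
  qed
  \<comment> \<open>Each of the three mixed terms equals \<open>b * sconj b / of_real D\<close>;
    with signs minus, minus, plus, one negative copy survives.\<close>
  with R have "of_real R = of_real A - b * sconj b / of_real D"
    using assms(1) by (simp add: c mult.commute)
  then have "of_real R = (of_real (A - (norm b)\<^sup>2 / D) :: 'a)"
    by (simp add: mult_sconj_of_real)
  then show ?thesis
    by (simp only: of_real_eq_iff)
qed

text \<open>Cauchy--Schwarz for nonnegative integrals bounds only a square; this takes the root
  without assuming in advance that \<open>a\<close> is finite.\<close>

lemma ennreal_le_of_power2_le:
  assumes "a\<^sup>2 \<le> ennreal (c\<^sup>2)" "0 \<le> c"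
  shows "a \<le> ennreal c"
proof (cases a)
  case (real r)
  then have "r\<^sup>2 \<le> c\<^sup>2"
    using assms by (simp add: ennreal_power ennreal_le_iff)
  then have "r \<le> c"
    using assms(2) by (rule power2_le_imp_le)
  with real show ?thesis
    by (simp add: ennreal_leI)
next
  case top
  then show ?thesis
    using assms(1) by (simp add: top_unique power2_eq_square)
qed

section \<open>The inner product and Cauchy--Schwarz\<close>

context hilbert_space
begin

lemma ip_add_right: "ip f (g + h) = ip f g + ip f h"
  by (metis ip_commute ip_add sconj_add)

lemma ip_scale_right: "ip f (smul c g) = sconj c * ip f g"
  by (metis ip_commute ip_scale sconj_mult)

lemma ip_zero_left [simp]: "ip 0 f = 0"
  using ip_add[of 0 0 f] by simp

lemma ip_zero_right [simp]: "ip f 0 = 0"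
  using ip_add_right[of f 0 0] by simp

lemma ip_diff: "ip (f - g) h = ip f h - ip g h"
  using ip_add[of "f - g" g h] by simp

lemma ip_diff_right: "ip f (g - h) = ip f g - ip f h"
  using ip_add_right[of f "g - h" h] by simp

lemma ip_scaleR: "ip (r *\<^sub>R f) g = of_real r * ip f g"
  by (metis ip_scale scale_of_real)

lemma ip_self_eq_zero: "ip f f = 0 \<longleftrightarrow> f = 0"
  by (simp add: ip_norm del: of_real_power)

lemma ip_eqI:
  assumes "\<And>g. ip f g = ip h g"
  shows "f = h"
proof -
  have "ip (f - h) (f - h) = 0"
    using assms[of "f - h"] by (simp add: ip_diff)
  then show ?thesis
    by (simp add: ip_self_eq_zero)
qed

text \<open>Serves twice: nonnegativity of the left side gives Cauchy--Schwarz, and at a nearest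
  point the subtracted term has to vanish, which gives orthogonality.\<close>

lemma norm_residual:
  assumes "v \<noteq> 0"
  shows "(norm (f - smul (ip f v / of_real ((norm v)\<^sup>2)) v))\<^sup>2
    = (norm f)\<^sup>2 - (norm (ip f v))\<^sup>2 / (norm v)\<^sup>2"
proof (rule residual_square)
  show "(norm v)\<^sup>2 \<noteq> 0"
    using assms by simp
  show "of_real ((norm (f - smul (ip f v / of_real ((norm v)\<^sup>2)) v))\<^sup>2)
    = of_real ((norm f)\<^sup>2) - sconj (ip f v / of_real ((norm v)\<^sup>2)) * ip f v
      - ip f v / of_real ((norm v)\<^sup>2) * sconj (ip f v)
      + ip f v / of_real ((norm v)\<^sup>2) * sconj (ip f v / of_real ((norm v)\<^sup>2))
        * of_real ((norm v)\<^sup>2)"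
    unfolding ip_norm[symmetric] ip_diff ip_diff_right ip_scale ip_scale_right ip_commute[of f v]
    by (simp add: algebra_simps sconj_sconj)
qed (rule refl)

lemma ip_Cauchy_Schwarz: "norm (ip f g) \<le> norm f * norm g"
proof (cases "g = 0")
  case False
  have "(norm (ip f g))\<^sup>2 / (norm g)\<^sup>2 \<le> (norm f)\<^sup>2"
    using norm_residual[OF False, of f]
      zero_le_power2[of "norm (f - smul (ip f g / of_real ((norm g)\<^sup>2)) g)"] by linarith
  then have "(norm (ip f g))\<^sup>2 \<le> (norm f * norm g)\<^sup>2"
    using False by (simp add: divide_le_eq power_mult_distrib)
  then show ?thesis
    by (rule power2_le_imp_le) simp
qed simp

section \<open>Orthogonal projections and Riesz representation on closed subspaces\<close>

lemma parallelogram: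
  fixes f g :: 'h
  shows "(norm (f + g))\<^sup>2 + (norm (f - g))\<^sup>2 = 2 * (norm f)\<^sup>2 + 2 * (norm g)\<^sup>2"
proof -
  have "of_real ((norm (f + g))\<^sup>2 + (norm (f - g))\<^sup>2) = (of_real (2 * (norm f)\<^sup>2 + 2 * (norm g)\<^sup>2) :: 's)"
    by (simp add: ip_add ip_add_right ip_diff ip_diff_right del: of_real_power flip: ip_norm)
  then show ?thesis
    by (simp only: of_real_eq_iff)
qed

lemma subspace_scaleR: "subspace V \<Longrightarrow> v \<in> V \<Longrightarrow> r *\<^sub>R v \<in> V"
  using subspace_scale[of V v "of_real r"] by (simp add: scale_of_real)

text \<open>A minimising sequence is Cauchy: the midpoint of two of its terms lies in
  \<open>V\<close>, so it is no nearer to \<open>f\<close> than the infimum, and the parallelogram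
  law then keeps the two terms close. Completeness gives the limit, closedness keeps it in
  \<open>V\<close>.\<close>

lemma nearest_point_exists:
  assumes V: "subspace V" "closed V"
  obtains u where "u \<in> V" "\<And>v. v \<in> V \<Longrightarrow> norm (f - u) \<le> norm (f - v)"
proof -
  define d where "d = (INF v\<in>V. norm (f - v))"
  have bdd: "bdd_below ((\<lambda>v. norm (f - v)) ` V)"
    by (rule bdd_belowI2[where m = 0]) simp
  have ne: "V \<noteq> {}"
    using subspace_0[OF V(1)] by auto
  have d_le: "d \<le> norm (f - v)" if "v \<in> V" for v
    unfolding d_def using bdd that by (rule cINF_lower)
  have d0: "0 \<le> d"
    unfolding d_def using ne by (intro cINF_greatest) auto
  have "\<exists>v\<in>V. norm (f - v) < d + 1 / Suc n" for n
    using cINF_less_iff[OF ne bdd, of "d + 1 / Suc n"] unfolding d_def by simp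
  then obtain s where s: "\<And>n. s n \<in> V" "\<And>n. norm (f - s n) < d + 1 / Suc n"
    by metis
  have lim: "(\<lambda>n. norm (f - s n)) \<longlonglongrightarrow> d"
  proof (rule tendsto_sandwich[where f = "\<lambda>_. d"])
    show "(\<lambda>n. d + 1 / Suc n) \<longlonglongrightarrow> d"
      using tendsto_add[OF tendsto_const[of d] LIMSEQ_inverse_real_of_nat]
      by (simp add: inverse_eq_divide)
    show "\<forall>\<^sub>F n in sequentially. norm (f - s n) \<le> d + 1 / Suc n"
      using less_imp_le[OF s(2)] by (intro always_eventually allI)
  qed (use d_le s(1) in simp_all)
  have near: "(norm (s m - s n))\<^sup>2 \<le> 2 * (norm (f - s m))\<^sup>2 + 2 * (norm (f - s n))\<^sup>2 - 4 * d\<^sup>2" for m n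
  proof -
    define a where "a = (1/2) *\<^sub>R (s m + s n)"
    have "a \<in> V"
      unfolding a_def using V(1) s(1) by (intro subspace_scaleR subspace_add)
    have "(f - s m) + (f - s n) = 2 *\<^sub>R (f - a)"
      by (simp add: a_def algebra_simps scaleR_2)
    then have "(norm ((f - s m) + (f - s n)))\<^sup>2 = 4 * (norm (f - a))\<^sup>2"
      by (simp add: power_mult_distrib)
    moreover have "d\<^sup>2 \<le> (norm (f - a))\<^sup>2"
      using d_le[OF \<open>a \<in> V\<close>] d0 by (rule power_mono)
    ultimately show ?thesis
      using parallelogram[of "f - s m" "f - s n"] by (simp add: norm_minus_commute)
  qed
  have "Cauchy s"
  proof (rule metric_CauchyI)
    fix e :: real
    assume "0 < e"
    have "(\<lambda>n. (norm (f - s n))\<^sup>2) \<longlonglongrightarrow> d\<^sup>2"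
      using lim by (rule tendsto_power)
    \<comment> \<open>The choice of \<open>e\<^sup>2 / 4\<close> makes the two doubled terms in
      \<open>near\<close> add up to less than \<open>4 * d\<^sup>2 + e\<^sup>2\<close>.\<close>
    then have "\<forall>\<^sub>F n in sequentially. (norm (f - s n))\<^sup>2 < d\<^sup>2 + e\<^sup>2 / 4"
      by (rule order_tendstoD) (use \<open>0 < e\<close> in simp)
    then obtain N where N: "\<And>n. n \<ge> N \<Longrightarrow> (norm (f - s n))\<^sup>2 < d\<^sup>2 + e\<^sup>2 / 4"
      by (auto simp: eventually_sequentially)
    have "dist (s m) (s n) < e" if "m \<ge> N" "n \<ge> N" for m n
    proof -
      have "(norm (s m - s n))\<^sup>2 < e\<^sup>2"
        using near[of m n] N[OF that(1)] N[OF that(2)] by simp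
      then show ?thesis
        using \<open>0 < e\<close> by (simp add: dist_norm power_less_imp_less_base)
    qed
    then show "\<exists>N. \<forall>m\<ge>N. \<forall>n\<ge>N. dist (s m) (s n) < e"
      by blast
  qed
  then obtain u where u: "s \<longlonglongrightarrow> u"
    by (auto simp: Cauchy_convergent_iff convergent_def)
  have "u \<in> V"
    using V(2) s(1) u by (rule closed_sequentially)
  have "(\<lambda>n. norm (f - s n)) \<longlonglongrightarrow> norm (f - u)"
    by (intro tendsto_intros u)
  then have "norm (f - u) = d"
    using lim by (rule LIMSEQ_unique)
  then show thesis
    using that \<open>u \<in> V\<close> d_le by simp
qed

text \<open>The nearest point works: if \<open>f - u\<close> had a nonzero component along some
  \<open>v\<close> in \<open>V\<close>, moving \<open>u\<close> by that component would bring it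
  strictly nearer to \<open>f\<close>.\<close>

lemma orth_proj_exists:
  assumes V: "subspace V" "closed V"
  shows "\<exists>u\<in>V. \<forall>v\<in>V. ip (f - u) v = 0"
proof -
  obtain u where u: "u \<in> V" "\<And>v. v \<in> V \<Longrightarrow> norm (f - u) \<le> norm (f - v)"
    using nearest_point_exists[OF V] by metis
  have "ip (f - u) v = 0" if "v \<in> V" for v
  proof (cases "v = 0")
    case False
    define c where "c = ip (f - u) v / of_real ((norm v)\<^sup>2)"
    have "norm (f - u) \<le> norm (f - u - smul c v)"
      using u(2)[of "u + smul c v"] u(1) that V(1)
      by (simp add: subspace_add subspace_scale diff_diff_eq)
    then have "(norm (f - u))\<^sup>2 \<le> (norm (f - u - smul c v))\<^sup>2"
      by (simp add: power_mono)
    also have "\<dots> = (norm (f - u))\<^sup>2 - (norm (ip (f - u) v))\<^sup>2 / (norm v)\<^sup>2"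
      unfolding c_def by (rule norm_residual[OF False])
    finally have "(norm (ip (f - u) v))\<^sup>2 / (norm v)\<^sup>2 \<le> 0"
      by simp
    then show ?thesis
      using False by (simp add: divide_le_0_iff)
  qed simp
  with u(1) show ?thesis
    by blast
qed

text \<open>The difference of two candidates lies in \<open>V\<close> and is orthogonal to itself,
  hence zero. Later identities for \<open>orth_proj\<close> are proved by checking the defining
  property through this rule.\<close>

lemma orth_proj_eqI:
  assumes "subspace V" "u \<in> V" "\<And>v. v \<in> V \<Longrightarrow> ip (f - u) v = 0"
  shows "orth_proj ip V f = u"
  unfolding orth_proj_def
proof (rule the_equality)
  fix w
  assume w: "w \<in> V \<and> (\<forall>v\<in>V. ip (f - w) v = 0)"
  then have "u - w \<in> V"
    using assms by (simp add: subspace_diff)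
  then have "ip (f - w) (u - w) - ip (f - u) (u - w) = 0"
    using w assms(3) by simp
  then have "ip (u - w) (u - w) = 0"
    by (simp add: ip_diff)
  then show "w = u"
    by (simp add: ip_self_eq_zero)
qed (use assms in blast)

context
  fixes V
  assumes V: "subspace V" "closed V"
begin

lemma orth_proj_props:
  shows orth_proj_mem: "orth_proj ip V f \<in> V"
    and ip_orth_proj_residual: "v \<in> V \<Longrightarrow> ip (f - orth_proj ip V f) v = 0"
proof -
  obtain u where u: "u \<in> V" "\<forall>v\<in>V. ip (f - u) v = 0"
    using orth_proj_exists[OF V] by blast
  then have "orth_proj ip V f = u"
    using orth_proj_eqI[OF V(1)] by blast
  with u show "orth_proj ip V f \<in> V" "v \<in> V \<Longrightarrow> ip (f - orth_proj ip V f) v = 0"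
    by auto
qed

lemma orth_proj_idem: "v \<in> V \<Longrightarrow> orth_proj ip V v = v"
  by (rule orth_proj_eqI[OF V(1)]) simp_all

lemma orth_proj_add: "orth_proj ip V (f + g) = orth_proj ip V f + orth_proj ip V g"
proof (rule orth_proj_eqI[OF V(1)])
  fix v
  assume "v \<in> V"
  then show "ip (f + g - (orth_proj ip V f + orth_proj ip V g)) v = 0"
    using ip_orth_proj_residual[of v f] ip_orth_proj_residual[of v g] by (simp add: ip_diff ip_add)
qed (simp add: V subspace_add orth_proj_mem)

lemma orth_proj_scale: "orth_proj ip V (smul c f) = smul c (orth_proj ip V f)"
proof (rule orth_proj_eqI[OF V(1)])
  fix v
  assume "v \<in> V"
  then show "ip (smul c f - smul c (orth_proj ip V f)) v = 0"
    using ip_orth_proj_residual[of v f] by (simp add: ip_diff ip_scale)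
qed (simp add: V subspace_scale orth_proj_mem)

text \<open>The residual is orthogonal to the projection \<open>p\<close>, so
  \<open>ip p p = ip f p\<close>; Cauchy--Schwarz then leaves one factor \<open>norm p\<close> to
  cancel.\<close>

lemma norm_orth_proj_le: "norm (orth_proj ip V f) \<le> norm f"
proof -
  define p where "p = orth_proj ip V f"
  have "ip p p = ip f p"
    using ip_orth_proj_residual[OF orth_proj_mem, of f] by (simp add: p_def ip_diff)
  then have "(norm p)\<^sup>2 = norm (ip f p)"
    by (metis ip_norm norm_of_real abs_of_nonneg zero_le_power2)
  also have "\<dots> \<le> norm f * norm p"
    by (rule ip_Cauchy_Schwarz)
  finally show ?thesis
    unfolding p_def[symmetric] by (cases "p = 0") (simp_all add: power2_eq_square)
qed

text \<open>A functional is determined by its closed kernel and one vector \<open>z\<close>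
  orthogonal to the kernel, because every \<open>v\<close> differs from a multiple of
  \<open>z\<close> by a kernel element. A general closed \<open>V\<close> is allowed since the
  adjoints of the local operators live on the fibres \<open>F x\<close>; the other applications take
  \<open>V = UNIV\<close>.\<close>

theorem riesz_representation:
  assumes add: "\<And>u v. u \<in> V \<Longrightarrow> v \<in> V \<Longrightarrow> \<phi> (u + v) = \<phi> u + \<phi> v"
    and scale: "\<And>c u. u \<in> V \<Longrightarrow> \<phi> (smul c u) = c * \<phi> u"
    and bound: "\<And>u. u \<in> V \<Longrightarrow> norm (\<phi> u) \<le> C * norm u"
  obtains u where "u \<in> V" "\<And>v. v \<in> V \<Longrightarrow> \<phi> v = ip v u"
proof (cases "\<forall>v\<in>V. \<phi> v = 0")
  case True
  then show thesis
    using that[of 0] V(1) by (simp add: subspace_0)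
next
  case False
  then obtain w where w: "w \<in> V" "\<phi> w \<noteq> 0"
    by blast
  define N where "N = {v \<in> V. \<phi> v = 0}"
  have zero: "\<phi> 0 = 0"
    using scale[of 0 0] V(1) by (simp add: subspace_0)
  have diff: "\<phi> (u - v) = \<phi> u - \<phi> v" if "u \<in> V" "v \<in> V" for u v
    using add[of "u - v" v] that V(1) by (simp add: subspace_diff)
  have N: "subspace N"
    unfolding N_def subspace_def using V(1) zero
    by (auto simp: add scale subspace_0 subspace_add subspace_scale)
  have "closed N"
    unfolding closed_sequential_limits
  proof (intro allI impI, elim conjE)
    fix s l
    assume s: "\<forall>n. s n \<in> N" and l: "s \<longlonglongrightarrow> l"
    have "l \<in> V"
      using V(2) _ l by (rule closed_sequentially) (use s in \<open>simp add: N_def\<close>)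
    \<comment> \<open>Since \<open>s n\<close> lies in the kernel,
      \<open>\<phi> l = \<phi> (l - s n)\<close>, and the bound on the right tends to zero.\<close>
    have "norm (\<phi> l) \<le> C * norm (l - s n)" for n
    proof -
      have "s n \<in> V" "\<phi> (s n) = 0"
        using s by (auto simp: N_def)
      then show ?thesis
        using diff[of l "s n"] bound[of "l - s n"] \<open>l \<in> V\<close> V(1) by (simp add: subspace_diff)
    qed
    moreover have "(\<lambda>n. C * norm (l - s n)) \<longlonglongrightarrow> C * norm (l - l)"
      by (intro tendsto_intros l)
    ultimately have "norm (\<phi> l) \<le> C * norm (l - l)"
      by (intro LIMSEQ_le_const) auto
    with \<open>l \<in> V\<close> show "l \<in> N"
      by (simp add: N_def)
  qed
  then obtain p where p: "p \<in> N" "\<And>v. v \<in> N \<Longrightarrow> ip (w - p) v = 0"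
    using orth_proj_exists[OF N] by metis
  define z where "z = w - p"
  have z: "z \<in> V" "\<phi> z = \<phi> w"
    using w p(1) V(1) by (auto simp: z_def N_def subspace_diff diff)
  then have "z \<noteq> 0"
    using zero w by auto
  have orth: "ip v z = 0" if "v \<in> N" for v
    using p(2)[OF that] by (metis ip_commute sconj_zero z_def)
  have zz: "ip z z = of_real ((norm z)\<^sup>2)"
    by (rule ip_norm)
  \<comment> \<open>Normalised so that \<open>a * ip z z = \<phi> z\<close>. The representing vector
    carries \<open>sconj a\<close> because \<open>ip\<close> is conjugate linear in its second
    argument.\<close>
  define a where "a = \<phi> w / of_real ((norm z)\<^sup>2)"
  have "\<phi> v = ip v (smul (sconj a) z)" if "v \<in> V" for v
  proof -
    have "v - smul (\<phi> v / \<phi> w) z \<in> N"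
      using that z w(2) V(1) by (simp add: N_def subspace_diff subspace_scale diff scale)
    then have "ip v z = \<phi> v / \<phi> w * of_real ((norm z)\<^sup>2)"
      using orth[of "v - smul (\<phi> v / \<phi> w) z"] zz by (simp add: ip_diff ip_scale)
    then show ?thesis
      using w(2) \<open>z \<noteq> 0\<close> by (simp add: ip_scale_right sconj_sconj a_def)
  qed
  moreover have "smul (sconj a) z \<in> V"
    using z(1) V(1) by (simp add: subspace_scale)
  ultimately show thesis
    using that by blast
qed

end

section \<open>Bounded operators: adjoints, forms and left inverses\<close>

lemma bounded_op_iff:
  "bounded_op smul T \<longleftrightarrow> (\<forall>f g. T (f + g) = T f + T g) \<and> (\<forall>c f. T (smul c f) = smul c (T f))
    \<and> (\<exists>C. \<forall>f. norm (T f) \<le> C * norm f)"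
  unfolding bounded_op_def Vector_Spaces.linear_iff using vector_space_axioms by auto

lemma bounded_op_bounded_linear:
  assumes "bounded_op smul T"
  shows "bounded_linear T"
proof -
  obtain C where "\<And>f. norm (T f) \<le> C * norm f"
    using assms unfolding bounded_op_iff by blast
  then show ?thesis
    using assms unfolding bounded_op_iff
    by (intro bounded_linear_intro[where K = C])
      (simp_all add: mult.commute flip: scale_of_real)
qed

lemma bounded_op_compose:
  assumes "bounded_op smul T" "bounded_op smul U"
  shows "bounded_op smul (\<lambda>f. T (U f))"
proof -
  obtain C where C: "\<And>f. norm (T f) \<le> C * norm f"
    using assms(1) unfolding bounded_op_iff by blast
  obtain D where D: "\<And>f. norm (U f) \<le> D * norm f"
    using assms(2) unfolding bounded_op_iff by blast
  \<comment> \<open>On the zero space \<open>C\<close> could be negative; \<open>max C 0\<close>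
    keeps multiplication by the bound monotone.\<close>
  have "norm (T (U f)) \<le> (max C 0 * D) * norm f" for f
  proof -
    have "norm (T (U f)) \<le> max C 0 * norm (U f)"
      using C[of "U f"] by (rule order_trans) (simp add: mult_right_mono)
    also have "\<dots> \<le> max C 0 * (D * norm f)"
      by (intro mult_left_mono D) simp
    finally show ?thesis
      by (simp add: ac_simps)
  qed
  then show ?thesis
    using assms unfolding bounded_op_iff by auto
qed

lemma bounded_op_scaleR:
  assumes "bounded_op smul T"
  shows "bounded_op smul (\<lambda>f. r *\<^sub>R T f)"
proof -
  have "bounded_op smul (\<lambda>f. smul (of_real r) f)"
    unfolding bounded_op_iff
  proof (intro conjI allI exI)
    show "norm (smul (of_real r) f) \<le> \<bar>r\<bar> * norm f" for f
      by (simp add: scale_of_real)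
  qed (rule scale_right_distrib scale_left_commute)+
  then show ?thesis
    using bounded_op_compose[OF _ assms] by (simp add: scale_of_real)
qed

lemma left_inverse_bounded_below:
  assumes "bounded_op smul K" "\<And>f. K (S f) = f"
  shows "bounded_below S"
proof -
  obtain C where C: "\<And>f. norm (K f) \<le> C * norm f"
    using assms(1) unfolding bounded_op_iff by blast
  \<comment> \<open>From \<open>f = K (S f)\<close> the norm of \<open>f\<close> is at most
    \<open>C * norm (S f)\<close>; \<open>max C 1\<close> replaces \<open>C\<close> to have a
    positive divisor.\<close>
  have "1 / max C 1 * norm f \<le> norm (S f)" for f
  proof -
    have "norm f \<le> C * norm (S f)"
      using C[of "S f"] by (simp add: assms(2))
    also have "\<dots> \<le> max C 1 * norm (S f)"
      by (intro mult_right_mono) simp_all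
    finally show ?thesis
      by (simp add: divide_le_eq ac_simps)
  qed
  moreover have "0 < 1 / max C 1"
    by simp
  ultimately show ?thesis
    unfolding bounded_below_def by blast
qed

text \<open>For fixed \<open>g\<close> the functional sending \<open>f\<close> to
  \<open>ip (T f) g\<close> is bounded by Cauchy--Schwarz, so Riesz represents it.\<close>

lemma bounded_op_adjoint:
  assumes "bounded_op smul T"
  obtains T' where "\<And>f g. ip (T f) g = ip f (T' g)"
proof -
  obtain C where C: "\<And>f. norm (T f) \<le> C * norm f"
    using assms unfolding bounded_op_iff by blast
  have "\<exists>h. \<forall>f. ip (T f) g = ip f h" for g
  proof (rule riesz_representation[where V = UNIV and \<phi> = "\<lambda>f. ip (T f) g" and C = "C * norm g"])
    fix f
    have "norm (ip (T f) g) \<le> norm (T f) * norm g"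
      by (rule ip_Cauchy_Schwarz)
    also have "\<dots> \<le> C * norm f * norm g"
      by (intro mult_right_mono C) simp
    finally show "norm (ip (T f) g) \<le> C * norm g * norm f"
      by (simp add: ac_simps)
  qed (use assms in \<open>auto simp: bounded_op_iff ip_add ip_scale\<close>)
  then show thesis
    using that by metis
qed

text \<open>Linearity follows by testing against every \<open>g\<close>. For the bound, testing
  \<open>T f\<close> against itself gives a surplus factor \<open>norm (T f)\<close>, which cancels
  unless it is zero.\<close>

lemma bounded_op_form:
  assumes form: "\<And>f g. ip (T f) g = a f g"
    and add: "\<And>f h g. a (f + h) g = a f g + a h g"
    and scale: "\<And>c f g. a (smul c f) g = c * a f g"
    and bound: "\<And>f g. norm (a f g) \<le> C * norm f * norm g"
  shows "bounded_op smul T"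
  unfolding bounded_op_iff
proof (intro conjI allI exI)
  show "T (f + g) = T f + T g" for f g
    by (rule ip_eqI) (simp add: form add ip_add)
  show "T (smul c f) = smul c (T f)" for c f
    by (rule ip_eqI) (simp add: form scale ip_scale)
  fix f
  have "(norm (T f))\<^sup>2 = norm (a f (T f))"
    by (metis form ip_norm norm_of_real abs_of_nonneg zero_le_power2)
  also have "\<dots> \<le> C * norm f * norm (T f)"
    by (rule bound)
  finally have "norm (T f) * norm (T f) \<le> (C * norm f) * norm (T f)"
    by (simp add: power2_eq_square)
  then have le: "T f \<noteq> 0 \<Longrightarrow> norm (T f) \<le> C * norm f"
    by simp
  show "norm (T f) \<le> max C 0 * norm f"
  proof (cases "T f = 0")
    case False
    then have "norm (T f) \<le> C * norm f"
      by (rule le)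
    also have "\<dots> \<le> max C 0 * norm f"
      by (intro mult_right_mono) simp_all
    finally show ?thesis .
  qed simp
qed

text \<open>Projecting onto the closed range first extends the inverse of \<open>S\<close> to the
  whole space. The bound on \<open>K\<close> comes from
  \<open>c * norm (K g) \<le> norm (S (K g))\<close>, where \<open>S (K g)\<close> is the projection
  of \<open>g\<close>.\<close>

lemma bounded_below_left_inverse:
  assumes S: "bounded_op smul S" and "bounded_below S"
  obtains K where "bounded_op smul K" "\<And>f. K (S f) = f"
proof -
  obtain c where c: "c > 0" "\<And>f. c * norm f \<le> norm (S f)"
    using assms(2) unfolding bounded_below_def by blast
  have lin: "\<And>f g. S (f + g) = S f + S g" "\<And>a f. S (smul a f) = smul a (S f)"
    using S unfolding bounded_op_iff by auto
  have S_bl: "bounded_linear S"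
    using S by (rule bounded_op_bounded_linear)
  have inj: "inj S"
  proof (rule injI)
    fix f g
    assume "S f = S g"
    then have "S (f - g) = 0"
      using bounded_linear.linear[OF S_bl] by (simp add: linear_diff)
    then have "c * norm (f - g) \<le> 0"
      using c(2)[of "f - g"] by simp
    then show "f = g"
      using c(1) by (simp add: mult_le_0_iff)
  qed
  have sub: "subspace (range S)"
    unfolding subspace_def
  proof (intro conjI ballI allI)
    show "0 \<in> range S"
      using linear_0[OF bounded_linear.linear[OF S_bl]] by (metis rangeI)
  qed (auto simp: lin[symmetric])
  have "complete (range S)"
    by (rule complete_isometric_image[OF c(1) _ S_bl]) (use c(2) in \<open>auto simp: complete_UNIV\<close>)
  then have closed: "closed (range S)"
    by (rule complete_imp_closed)
  define K where "K = (\<lambda>g. inv S (orth_proj ip (range S) g))"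
  have SK: "S (K g) = orth_proj ip (range S) g" for g
    unfolding K_def using orth_proj_mem[OF sub closed] by (rule f_inv_into_f)
  have "bounded_op smul K"
    unfolding bounded_op_iff
  proof (intro conjI allI exI)
    \<comment> \<open>Identities for \<open>K\<close> are checked after applying \<open>S\<close>,
      which turns them into identities for the projection, and are pulled back by
      injectivity.\<close>
    show "K (f + g) = K f + K g" for f g
      using inj by (rule injD) (simp add: lin SK orth_proj_add[OF sub closed])
    show "K (smul a f) = smul a (K f)" for a f
      using inj by (rule injD) (simp add: lin SK orth_proj_scale[OF sub closed])
    fix g
    have "c * norm (K g) \<le> norm g"
      using c(2)[of "K g"] norm_orth_proj_le[OF sub closed, of g] by (simp add: SK)
    then show "norm (K g) \<le> (1 / c) * norm g"
      using c(1) by (simp add: field_simps)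
  qed
  moreover have "K (S f) = f" for f
    using inj by (rule injD) (simp add: SK orth_proj_idem[OF sub closed])
  ultimately show thesis
    by (rule that)
qed

section \<open>Weak integrals\<close>

lemma has_weak_integral_unique:
  assumes "has_weak_integral ip M u v" "has_weak_integral ip M u w"
  shows "v = w"
  using assms by (intro ip_eqI) (simp add: has_weak_integral_def)

lemma weak_integral_eqI: "has_weak_integral ip M u v \<Longrightarrow> weak_integral ip M u = v"
  unfolding weak_integral_def using has_weak_integral_unique by blast

text \<open>Testing \<open>T (u x)\<close> against \<open>g\<close> is the same as testing
  \<open>u x\<close> against \<open>T' g\<close>.\<close>

lemma has_weak_integral_adjoint:
  assumes "has_weak_integral ip M u v" "\<And>f g. ip (T f) g = ip f (T' g)"
  shows "has_weak_integral ip M (\<lambda>x. T (u x)) (T v)"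
  using assms by (simp add: has_weak_integral_def)

text \<open>Riesz needs a functional linear in \<open>g\<close>, so it is applied to the integral of
  \<open>ip g (u x)\<close>; the weak integral has the arguments in the other order and is recovered
  by conjugating.\<close>

lemma has_weak_integral_form:
  assumes meas: "\<And>g. (\<lambda>x. ip g (u x)) \<in> borel_measurable M"
    and bound: "\<And>g. (\<integral>\<^sup>+x. ennreal (norm (ip g (u x))) \<partial>M) \<le> ennreal (C * norm g)"
  shows "\<exists>v. has_weak_integral ip M u v"
proof -
  have int: "integrable M (\<lambda>x. ip g (u x))" for g
  proof (rule integrableI_bounded[OF meas])
    show "(\<integral>\<^sup>+x. ennreal (norm (ip g (u x))) \<partial>M) < \<infinity>"
      using bound[of g] by (rule order_le_less_trans) simp
  qed
  obtain v where v: "\<And>g. (LINT x|M. ip g (u x)) = ip g v"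
  proof (rule riesz_representation[where V = UNIV and \<phi> = "\<lambda>g. LINT x|M. ip g (u x)" and C = "max C 0"])
    fix g
    have "ennreal (norm (LINT x|M. ip g (u x))) \<le> ennreal (C * norm g)"
      using integral_norm_bound_ennreal[OF int] bound by (rule order_trans)
    also have "\<dots> \<le> ennreal (max C 0 * norm g)"
      by (intro ennreal_leI mult_right_mono) simp_all
    finally show "norm (LINT x|M. ip g (u x)) \<le> max C 0 * norm g"
      by (simp add: ennreal_le_iff)
  qed (auto simp: ip_add ip_scale int)
  have conj: "(\<lambda>x. ip (u x) g) = (\<lambda>x. sconj (ip g (u x)))" for g
    by (intro ext ip_commute)
  have "has_weak_integral ip M u v"
    unfolding has_weak_integral_def
  proof (intro allI conjI)
    fix g
    show "integrable M (\<lambda>x. ip (u x) g)"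
      unfolding conj using bounded_linear_sconj int by (rule integrable_bounded_linear)
    have "ip v g = sconj (LINT x|M. ip g (u x))"
      unfolding v by (rule ip_commute)
    also have "\<dots> = (LINT x|M. ip (u x) g)"
      unfolding conj using integral_bounded_linear[OF bounded_linear_sconj int] by simp
    finally show "ip v g = (LINT x|M. ip (u x) g)" .
  qed
  then show ?thesis ..
qed

end

section \<open>The local Hilbert spaces with explicit carrier\<close>

context hilbert_space_on
begin

lemma h_ip_self: "u \<in> h_carrier H \<Longrightarrow> h_ip H u u = of_real ((h_norm H u)\<^sup>2)"
  using ip_nonneg[of u] by (auto simp: h_norm_def)

lemma h_norm_nonneg [simp]: "0 \<le> h_norm H u"
  by (simp add: h_norm_def)

lemma ip_add_right:
  "\<lbrakk>u \<in> h_carrier H; v \<in> h_carrier H; w \<in> h_carrier H\<rbrakk>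
    \<Longrightarrow> h_ip H w (h_add H u v) = h_ip H w u + h_ip H w v"
  by (simp add: ip_commute[of _ w] ip_add sconj_add add_closed)

lemma ip_scale_right:
  "\<lbrakk>u \<in> h_carrier H; v \<in> h_carrier H\<rbrakk> \<Longrightarrow> h_ip H v (h_scale H c u) = sconj c * h_ip H v u"
  by (simp add: ip_commute[of _ v] ip_scale sconj_mult scale_closed)

text \<open>The residual argument of the ambient space, repeated with the operations of the
  structure \<open>H\<close>.\<close>

lemma h_Cauchy_Schwarz:
  assumes u: "u \<in> h_carrier H" and v: "v \<in> h_carrier H"
  shows "norm (h_ip H u v) \<le> h_norm H u * h_norm H v"
proof (cases "h_norm H v = 0")
  case True
  then have "v = h_zero H"
    using h_ip_self[OF v] ip_definite[OF v] by simp
  \<comment> \<open>Writing \<open>v\<close> as zero times itself makes its inner product with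
    \<open>u\<close> vanish by linearity.\<close>
  moreover have "h_scale H 0 v = h_zero H"
    using v by (intro ip_definite) (simp_all add: scale_closed ip_scale)
  ultimately have "h_ip H v u = 0"
    using ip_scale[OF v u, of 0] by simp
  then have "h_ip H u v = 0"
    using ip_commute[OF v u] by (simp add: sconj_zero)
  then show ?thesis
    using True by simp
next
  case False
  define c where "c = h_ip H u v / of_real ((h_norm H v)\<^sup>2)"
  define w where "w = h_add H u (h_scale H (- c) v)"
  have w: "w \<in> h_carrier H"
    unfolding w_def using u v by (simp add: add_closed scale_closed)
  have "(h_norm H w)\<^sup>2 = (h_norm H u)\<^sup>2 - (norm (h_ip H u v))\<^sup>2 / (h_norm H v)\<^sup>2"
  proof (rule residual_square[OF _ c_def])
    show "of_real ((h_norm H w)\<^sup>2) = of_real ((h_norm H u)\<^sup>2) - sconj c * h_ip H u v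
        - c * sconj (h_ip H u v) + c * sconj c * of_real ((h_norm H v)\<^sup>2)"
      using u v
      by (simp add: h_ip_self[symmetric] w ip_commute[OF u v, symmetric] del: of_real_power)
        (simp add: w_def ip_add ip_add_right ip_scale ip_scale_right add_closed scale_closed
          sconj_minus algebra_simps)
  qed (use False in simp)
  then have "(norm (h_ip H u v))\<^sup>2 / (h_norm H v)\<^sup>2 \<le> (h_norm H u)\<^sup>2"
    using zero_le_power2[of "h_norm H w"] by linarith
  moreover have "0 < h_norm H v"
    using False h_norm_nonneg[of v] by linarith
  ultimately have "(norm (h_ip H u v))\<^sup>2 \<le> (h_norm H u * h_norm H v)\<^sup>2"
    by (simp add: divide_le_eq power_mult_distrib)
  then show ?thesis
    by (rule power2_le_imp_le) simp
qed

end

section \<open>Local adjoints and pointwise facts on fusion mappings\<close>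

context hilbert_space
begin

text \<open>Riesz on \<open>V\<close>, applied to the functional sending \<open>v\<close> to
  \<open>h_ip H (L v) k\<close>, supplies the adjoint vector. Two such vectors differ by an element
  of \<open>V\<close> orthogonal to itself, so the definite description denotes.\<close>

lemma adjoint_into_props:
  assumes V: "subspace V" "closed V" and H: "hilbert_space_on H"
    and L: "bounded_linear_into smul V H L" and k: "k \<in> h_carrier H"
  shows adjoint_into_mem: "adjoint_into ip V H L k \<in> V"
    and ip_adjoint_into: "v \<in> V \<Longrightarrow> ip v (adjoint_into ip V H L k) = h_ip H (L v) k"
proof -
  interpret H: hilbert_space_on H
    by (rule H)
  obtain C where mem: "\<And>u. u \<in> V \<Longrightarrow> L u \<in> h_carrier H"
    and lin: "\<And>u v. u \<in> V \<Longrightarrow> v \<in> V \<Longrightarrow> L (u + v) = h_add H (L u) (L v)"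
      "\<And>c u. u \<in> V \<Longrightarrow> L (smul c u) = h_scale H c (L u)"
    and C: "\<And>u. u \<in> V \<Longrightarrow> h_norm H (L u) \<le> C * norm u"
    using L unfolding bounded_linear_into_def by blast
  obtain a where a: "a \<in> V" "\<And>v. v \<in> V \<Longrightarrow> h_ip H (L v) k = ip v a"
  proof (rule riesz_representation[OF V, where \<phi> = "\<lambda>v. h_ip H (L v) k" and C = "C * h_norm H k"])
    fix u
    assume u: "u \<in> V"
    have "norm (h_ip H (L u) k) \<le> h_norm H (L u) * h_norm H k"
      using mem[OF u] k by (rule H.h_Cauchy_Schwarz)
    also have "\<dots> \<le> C * norm u * h_norm H k"
      using C[OF u] by (rule mult_right_mono) simp
    finally show "norm (h_ip H (L u) k) \<le> C * h_norm H k * norm u"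
      by (simp add: ac_simps)
  qed (use k in \<open>auto simp: lin mem H.ip_add H.ip_scale\<close>)
  have "adjoint_into ip V H L k = a"
    unfolding adjoint_into_def
  proof (rule the_equality)
    fix b
    assume b: "b \<in> V \<and> (\<forall>v\<in>V. h_ip H (L v) k = ip v b)"
    then have "b - a \<in> V"
      using a(1) V(1) by (simp add: subspace_diff)
    then have "ip (b - a) b = ip (b - a) a"
      using a(2) b by metis
    then have "ip (b - a) (b - a) = 0"
      by (simp add: ip_diff_right)
    then show "b = a"
      by (simp add: ip_self_eq_zero)
  qed (use a in blast)
  with a show "adjoint_into ip V H L k \<in> V"
    "v \<in> V \<Longrightarrow> ip v (adjoint_into ip V H L k) = h_ip H (L v) k"
    by auto
qed

lemma fusion_mapping_point:
  assumes "fusion_mapping smul ip M H L F w" "x \<in> space M"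
  shows fusion_mapping_weight: "0 \<le> w x"
    and fusion_mapping_subspace: "subspace (F x)" "closed (F x)"
    and fusion_mapping_bounded: "bounded_linear_into smul (F x) (H x) (L x)"
  using assms unfolding fusion_mapping_def by auto

lemma fusion_mapping_carrier:
  assumes "fusion_mapping smul ip M H L F w" "x \<in> space M"
  shows "L x (orth_proj ip (F x) f) \<in> h_carrier (H x)"
  using fusion_mapping_bounded[OF assms] orth_proj_mem[OF fusion_mapping_subspace[OF assms]]
  unfolding bounded_linear_into_def by blast

lemma fusion_mapping_linear:
  assumes "fusion_mapping smul ip M H L F w" "x \<in> space M"
  shows "L x (orth_proj ip (F x) (f + g))
      = h_add (H x) (L x (orth_proj ip (F x) f)) (L x (orth_proj ip (F x) g))"
    and "L x (orth_proj ip (F x) (smul c f)) = h_scale (H x) c (L x (orth_proj ip (F x) f))"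
  using fusion_mapping_bounded[OF assms]
  unfolding orth_proj_add[OF fusion_mapping_subspace[OF assms]]
    orth_proj_scale[OF fusion_mapping_subspace[OF assms]] bounded_linear_into_def
  by (simp_all add: orth_proj_mem[OF fusion_mapping_subspace[OF assms]])

text \<open>The constant may depend on \<open>x\<close>; it serves to show that the mixed operator
  at each single point is bounded.\<close>

lemma fusion_mapping_pointwise_bound:
  assumes "fusion_mapping smul ip M H L F w" "x \<in> space M"
  obtains C where "0 \<le> C" "\<And>f. h_norm (H x) (L x (orth_proj ip (F x) f)) \<le> C * norm f"
proof -
  note V = fusion_mapping_subspace[OF assms]
  obtain C where C: "\<And>u. u \<in> F x \<Longrightarrow> h_norm (H x) (L x u) \<le> C * norm u"
    using fusion_mapping_bounded[OF assms] unfolding bounded_linear_into_def by blast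
  have "h_norm (H x) (L x (orth_proj ip (F x) f)) \<le> max C 0 * norm f" for f
  proof -
    have "h_norm (H x) (L x (orth_proj ip (F x) f)) \<le> C * norm (orth_proj ip (F x) f)"
      using orth_proj_mem[OF V] by (rule C)
    also have "\<dots> \<le> max C 0 * norm f"
      by (intro mult_mono norm_orth_proj_le[OF V]) simp_all
    finally show ?thesis .
  qed
  then show thesis
    by (intro that[of "max C 0"]) simp_all
qed

text \<open>The assumption concerns the squared function only; both factors are nonnegative, so the
  square root recovers their product.\<close>

lemma fusion_mapping_measurable:
  assumes "fusion_mapping smul ip M H L F w" "\<forall>x\<in>space M. hilbert_space_on (H x)"
  shows "(\<lambda>x. w x * h_norm (H x) (L x (orth_proj ip (F x) f))) \<in> borel_measurable M"
proof -
  have [measurable]: "(\<lambda>x. (w x)\<^sup>2 * (h_norm (H x) (L x (orth_proj ip (F x) f)))\<^sup>2) \<in> borel_measurable M"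
    using assms(1) unfolding fusion_mapping_def by blast
  have "(\<lambda>x. sqrt ((w x)\<^sup>2 * (h_norm (H x) (L x (orth_proj ip (F x) f)))\<^sup>2)) \<in> borel_measurable M"
    by measurable
  moreover have "sqrt ((w x)\<^sup>2 * (h_norm (H x) (L x (orth_proj ip (F x) f)))\<^sup>2)
      = w x * h_norm (H x) (L x (orth_proj ip (F x) f))" if "x \<in> space M" for x
    using fusion_mapping_weight[OF assms(1) that]
      hilbert_space_on.h_norm_nonneg[OF bspec[OF assms(2) that]]
    by (simp add: real_sqrt_mult)
  ultimately show ?thesis
    by (rule measurable_cong[THEN iffD1, rotated])
qed

section \<open>The mixed form and the mixed frame operator\<close>

context
  fixes M :: "'x measure" and H :: "'x \<Rightarrow> ('s, 'k) hilbert_struct"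
    and L R :: "'x \<Rightarrow> 'h \<Rightarrow> 'k" and F G :: "'x \<Rightarrow> 'h set" and w v :: "'x \<Rightarrow> real" and B D :: real
  assumes H: "\<forall>x\<in>space M. hilbert_space_on (H x)"
    and L: "bessel_fusion_mapping smul ip M H L F w B"
    and R: "bessel_fusion_mapping smul ip M H R G v D"
    and meas: "\<forall>f g. (\<lambda>x. h_ip (H x) (R x (orth_proj ip (G x) f)) (L x (orth_proj ip (F x) g)))
      \<in> borel_measurable M"
begin

lemma fusion_L: "fusion_mapping smul ip M H L F w"
  and fusion_R: "fusion_mapping smul ip M H R G v"
  using L R by (simp_all add: bessel_fusion_mapping_def)

text \<open>The adjoint vector \<open>p\<close> already lies in \<open>F x\<close>, so the outer
  projection fixes it, and \<open>g\<close> may be replaced by its projection because the residual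
  is orthogonal to \<open>p\<close>. This trades the definite descriptions in
  \<open>mixed_op\<close> for a plain form in \<open>H x\<close>.\<close>

lemma ip_mixed_op:
  assumes x: "x \<in> space M"
  shows "ip (mixed_op ip H L F R G x f) g
    = h_ip (H x) (R x (orth_proj ip (G x) f)) (L x (orth_proj ip (F x) g))"
proof -
  note V = fusion_mapping_subspace[OF fusion_L x]
  have Hx: "hilbert_space_on (H x)"
    using H x by blast
  note k = fusion_mapping_carrier[OF fusion_R x, of f]
  define p where "p = adjoint_into ip (F x) (H x) (L x) (R x (orth_proj ip (G x) f))"
  note adj = adjoint_into_props[OF V Hx fusion_mapping_bounded[OF fusion_L x] k, folded p_def]
  have "ip g p = ip (orth_proj ip (F x) g) p"
    using ip_orth_proj_residual[OF V adj(1), of g] by (simp add: ip_diff)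
  also have "\<dots> = h_ip (H x) (L x (orth_proj ip (F x) g)) (R x (orth_proj ip (G x) f))"
    by (rule adj(2)) (rule orth_proj_mem[OF V])
  finally have "sconj (ip g p)
      = sconj (h_ip (H x) (L x (orth_proj ip (F x) g)) (R x (orth_proj ip (G x) f)))"
    by (rule arg_cong)
  then have "ip p g = h_ip (H x) (R x (orth_proj ip (G x) f)) (L x (orth_proj ip (F x) g))"
    unfolding ip_commute[of p g]
      hilbert_space_on.ip_commute[OF Hx fusion_mapping_carrier[OF fusion_L x, of g] k] .
  then show ?thesis
    unfolding mixed_op_def p_def[symmetric] by (simp add: orth_proj_idem[OF V adj(1)])
qed

lemma norm_ip_mixed_op:
  assumes x: "x \<in> space M"
  shows "norm (ip (mixed_op ip H L F R G x f) g)
    \<le> h_norm (H x) (R x (orth_proj ip (G x) f)) * h_norm (H x) (L x (orth_proj ip (F x) g))"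
  unfolding ip_mixed_op[OF x] using H x fusion_mapping_carrier[OF fusion_R x]
    fusion_mapping_carrier[OF fusion_L x] by (intro hilbert_space_on.h_Cauchy_Schwarz) auto

lemma bounded_op_mixed_op:
  assumes x: "x \<in> space M"
  shows "bounded_op smul (mixed_op ip H L F R G x)"
proof -
  interpret Hx: hilbert_space_on "H x"
    using H x by blast
  obtain C where C: "0 \<le> C" "\<And>f. h_norm (H x) (L x (orth_proj ip (F x) f)) \<le> C * norm f"
    using fusion_mapping_pointwise_bound[OF fusion_L x] by blast
  obtain C' where C': "0 \<le> C'" "\<And>f. h_norm (H x) (R x (orth_proj ip (G x) f)) \<le> C' * norm f"
    using fusion_mapping_pointwise_bound[OF fusion_R x] by blast
  show ?thesis
  proof (rule bounded_op_form[OF ip_mixed_op[OF x], where C = "C' * C"])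
    fix f g
    have "norm (ip (mixed_op ip H L F R G x f) g) \<le> (C' * norm f) * (C * norm g)"
      using norm_ip_mixed_op[OF x] by (rule order_trans) (intro mult_mono C C', simp_all add: C')
    then show "norm (h_ip (H x) (R x (orth_proj ip (G x) f)) (L x (orth_proj ip (F x) g)))
        \<le> C' * C * norm f * norm g"
      unfolding ip_mixed_op[OF x] by (simp add: ac_simps)
  qed (simp_all add: fusion_mapping_linear[OF fusion_R x] Hx.ip_add Hx.ip_scale
      fusion_mapping_carrier[OF fusion_R x] fusion_mapping_carrier[OF fusion_L x])
qed

abbreviation mixed_integrand :: "'h \<Rightarrow> 'x \<Rightarrow> 'h" where
  "mixed_integrand f x \<equiv> (w x * v x) *\<^sub>R mixed_op ip H L F R G x f"

abbreviation energy :: "'h \<Rightarrow> ennreal" where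
  "energy f \<equiv> (\<integral>\<^sup>+x. ennreal ((v x)\<^sup>2 * (h_norm (H x) (R x (orth_proj ip (G x) f)))\<^sup>2) \<partial>M)"

abbreviation S :: "'h \<Rightarrow> 'h" where
  "S \<equiv> mixed_frame_op ip M H L F w R G v"

lemma mixed_integrand_measurable: "(\<lambda>x. ip (mixed_integrand f x) g) \<in> borel_measurable M"
proof -
  have [measurable]: "w \<in> borel_measurable M" "v \<in> borel_measurable M"
    using fusion_L fusion_R unfolding fusion_mapping_def by blast+
  have [measurable]: "(\<lambda>x. h_ip (H x) (R x (orth_proj ip (G x) f)) (L x (orth_proj ip (F x) g)))
      \<in> borel_measurable M"
    using meas by blast
  have "(\<lambda>x. (w x * v x) *\<^sub>R h_ip (H x) (R x (orth_proj ip (G x) f)) (L x (orth_proj ip (F x) g)))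
      \<in> borel_measurable M"
    by measurable
  then show ?thesis
    by (rule measurable_cong[THEN iffD1, rotated])
      (simp add: ip_scaleR ip_mixed_op scaleR_conv_of_real)
qed

text \<open>Cauchy--Schwarz is used twice, first in \<open>H x\<close> at each point and then for
  the integral. Only the factor with \<open>g\<close> is replaced by its Bessel bound: keeping
  \<open>energy f\<close> lets this estimate yield both the boundedness of \<open>S\<close> and the
  lower frame bound.\<close>

lemma mixed_integrand_bound:
  "(\<integral>\<^sup>+x. ennreal (norm (ip (mixed_integrand f x) g)) \<partial>M)\<^sup>2 \<le> energy f * ennreal (B * (norm g)\<^sup>2)"
proof -
  define a where "a = (\<lambda>x. v x * h_norm (H x) (R x (orth_proj ip (G x) f)))"
  define b where "b = (\<lambda>x. w x * h_norm (H x) (L x (orth_proj ip (F x) g)))"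
  have [measurable]: "a \<in> borel_measurable M" "b \<in> borel_measurable M"
    unfolding a_def b_def using fusion_L fusion_R H by (auto intro: fusion_mapping_measurable)
  have nonneg: "0 \<le> a x" "0 \<le> b x" if "x \<in> space M" for x
    unfolding a_def b_def using that H fusion_mapping_weight[OF fusion_L that]
      fusion_mapping_weight[OF fusion_R that] by (simp_all add: hilbert_space_on.h_norm_nonneg)
  have "norm (ip (mixed_integrand f x) g) \<le> a x * b x" if "x \<in> space M" for x
  proof -
    have "norm (ip (mixed_integrand f x) g)
        = w x * v x * norm (ip (mixed_op ip H L F R G x f) g)"
      using fusion_mapping_weight[OF fusion_L that] fusion_mapping_weight[OF fusion_R that]
      by (simp add: ip_scaleR norm_mult)
    also have "\<dots> \<le> w x * v x * (h_norm (H x) (R x (orth_proj ip (G x) f))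
        * h_norm (H x) (L x (orth_proj ip (F x) g)))"
      using fusion_mapping_weight[OF fusion_L that] fusion_mapping_weight[OF fusion_R that]
      by (intro mult_left_mono norm_ip_mixed_op[OF that]) simp
    finally show ?thesis
      by (simp add: a_def b_def ac_simps)
  qed
  then have "(\<integral>\<^sup>+x. ennreal (norm (ip (mixed_integrand f x) g)) \<partial>M)
      \<le> (\<integral>\<^sup>+x. ennreal (a x) * ennreal (b x) \<partial>M)"
    by (intro nn_integral_mono) (simp add: nonneg flip: ennreal_mult)
  then have "(\<integral>\<^sup>+x. ennreal (norm (ip (mixed_integrand f x) g)) \<partial>M)\<^sup>2
      \<le> (\<integral>\<^sup>+x. ennreal (a x) * ennreal (b x) \<partial>M)\<^sup>2"
    by (rule power_mono) simp
  also have "\<dots> \<le> (\<integral>\<^sup>+x. (ennreal (a x))\<^sup>2 \<partial>M) * (\<integral>\<^sup>+x. (ennreal (b x))\<^sup>2 \<partial>M)"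
    by (rule Cauchy_Schwarz_nn_integral) measurable
  also have "(\<integral>\<^sup>+x. (ennreal (a x))\<^sup>2 \<partial>M) = energy f"
    by (intro nn_integral_cong) (simp add: ennreal_power nonneg, simp add: a_def power_mult_distrib)
  also have "(\<integral>\<^sup>+x. (ennreal (b x))\<^sup>2 \<partial>M)
      = (\<integral>\<^sup>+x. ennreal ((w x)\<^sup>2 * (h_norm (H x) (L x (orth_proj ip (F x) g)))\<^sup>2) \<partial>M)"
    by (intro nn_integral_cong) (simp add: ennreal_power nonneg, simp add: b_def power_mult_distrib)
  also have "energy f * \<dots> \<le> energy f * ennreal (B * (norm g)\<^sup>2)"
    using L unfolding bessel_fusion_mapping_def by (intro mult_left_mono) auto
  finally show ?thesis .
qed

lemma energy_le: "energy f \<le> ennreal (D * (norm f)\<^sup>2)"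
  using R unfolding bessel_fusion_mapping_def by blast

lemma mixed_integrand_L1_bound:
  "(\<integral>\<^sup>+x. ennreal (norm (ip (mixed_integrand f x) g)) \<partial>M)
    \<le> ennreal (sqrt (D * B) * norm f * norm g)" (is "?I \<le> _")
proof (rule ennreal_le_of_power2_le)
  have pos: "0 < B" "0 < D"
    using L R by (auto simp: bessel_fusion_mapping_def)
  have "?I\<^sup>2 \<le> energy f * ennreal (B * (norm g)\<^sup>2)"
    by (rule mixed_integrand_bound)
  also have "\<dots> \<le> ennreal (D * (norm f)\<^sup>2) * ennreal (B * (norm g)\<^sup>2)"
    by (intro mult_right_mono energy_le) simp
  also have "\<dots> = ennreal ((D * (norm f)\<^sup>2) * (B * (norm g)\<^sup>2))"
    using pos by (intro ennreal_mult[symmetric]) simp_all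
  also have "(D * (norm f)\<^sup>2) * (B * (norm g)\<^sup>2) = (sqrt (D * B) * norm f * norm g)\<^sup>2"
    using pos by (simp add: power_mult_distrib)
  finally show "?I\<^sup>2 \<le> ennreal ((sqrt (D * B) * norm f * norm g)\<^sup>2)" .
  show "0 \<le> sqrt (D * B) * norm f * norm g"
    using pos by simp
qed

text \<open>Ensures that the definite description behind \<open>S\<close> denotes; afterwards
  \<open>S\<close> is handled only through this weak integral.\<close>

lemma has_weak_integral_mixed: "has_weak_integral ip M (mixed_integrand f) (S f)"
proof -
  have "\<exists>u. has_weak_integral ip M (mixed_integrand f) u"
  proof (rule has_weak_integral_form[where C = "sqrt (D * B) * norm f"])
    fix g
    have "(\<lambda>x. sconj (ip (mixed_integrand f x) g)) \<in> borel_measurable M"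
      using mixed_integrand_measurable
      by (rule measurable_compose)
        (intro borel_measurable_continuous_onI linear_continuous_on bounded_linear_sconj)
    then show "(\<lambda>x. ip g (mixed_integrand f x)) \<in> borel_measurable M"
      by (simp only: ip_commute[of g])
    have "norm (ip g (mixed_integrand f x)) = norm (ip (mixed_integrand f x) g)" for x
      by (simp only: ip_commute[of g] norm_sconj)
    then show "(\<integral>\<^sup>+x. ennreal (norm (ip g (mixed_integrand f x))) \<partial>M)
        \<le> ennreal (sqrt (D * B) * norm f * norm g)"
      using mixed_integrand_L1_bound by simp
  qed
  then obtain u where u: "has_weak_integral ip M (mixed_integrand f) u" ..
  then show ?thesis
    unfolding mixed_frame_op_def weak_integral_eqI[OF u] .
qed

lemma integrable_mixed: "integrable M (\<lambda>x. ip (mixed_integrand f x) g)"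
  and ip_mixed_frame_op: "ip (S f) g = (LINT x|M. ip (mixed_integrand f x) g)"
  using has_weak_integral_mixed unfolding has_weak_integral_def by auto

lemma norm_ip_mixed_frame_op:
  "ennreal (norm (ip (S f) g)) \<le> (\<integral>\<^sup>+x. ennreal (norm (ip (mixed_integrand f x) g)) \<partial>M)"
  unfolding ip_mixed_frame_op by (rule integral_norm_bound_ennreal[OF integrable_mixed])

lemma bounded_op_mixed_frame_op: "bounded_op smul S"
proof (rule bounded_op_form[OF ip_mixed_frame_op, where C = "sqrt (D * B)"])
  \<comment> \<open>Linearity of \<open>mixed_op\<close> is known only at points of
    \<open>space M\<close>, which suffices for congruence under the integral.\<close>
  have lin: "mixed_op ip H L F R G x (f + g) = mixed_op ip H L F R G x f + mixed_op ip H L F R G x g"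
    "mixed_op ip H L F R G x (smul c f) = smul c (mixed_op ip H L F R G x f)"
    if "x \<in> space M" for x f g c
    using bounded_op_mixed_op[OF that] unfolding bounded_op_iff by auto
  show "(LINT x|M. ip (mixed_integrand (f + h) x) g)
      = (LINT x|M. ip (mixed_integrand f x) g) + (LINT x|M. ip (mixed_integrand h x) g)" for f h g
  proof -
    have "(LINT x|M. ip (mixed_integrand (f + h) x) g)
        = (LINT x|M. ip (mixed_integrand f x) g + ip (mixed_integrand h x) g)"
      by (intro Bochner_Integration.integral_cong) (simp_all add: lin ip_scaleR ip_add algebra_simps)
    then show ?thesis
      by (simp add: integrable_mixed)
  qed
  show "(LINT x|M. ip (mixed_integrand (smul c f) x) g)
      = c * (LINT x|M. ip (mixed_integrand f x) g)" for c f g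
  proof -
    have "(LINT x|M. ip (mixed_integrand (smul c f) x) g)
        = (LINT x|M. c * ip (mixed_integrand f x) g)"
      by (intro Bochner_Integration.integral_cong) (simp_all add: lin ip_scaleR ip_scale)
    then show ?thesis
      by simp
  qed
  fix f g
  have "0 < B" "0 < D"
    using L R by (auto simp: bessel_fusion_mapping_def)
  moreover have "ennreal (norm (ip (S f) g)) \<le> ennreal (sqrt (D * B) * norm f * norm g)"
    using norm_ip_mixed_frame_op mixed_integrand_L1_bound by (rule order_trans)
  ultimately show "norm (LINT x|M. ip (mixed_integrand f x) g) \<le> sqrt (D * B) * norm f * norm g"
    unfolding ip_mixed_frame_op[symmetric] by (simp add: ennreal_le_iff)
qed

text \<open>The family applied to \<open>f\<close> always has the weak integral
  \<open>K (S f)\<close>, so by uniqueness it has the weak integral \<open>f\<close> exactly when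
  the two vectors agree.\<close>

lemma resolution_iff_left_inverse:
  assumes K: "bounded_op smul K"
  shows "resolution_of_identity smul ip M (\<lambda>x f. (w x * v x) *\<^sub>R K (mixed_op ip H L F R G x f))
    \<longleftrightarrow> (\<forall>f. K (S f) = f)"
proof -
  have K_lin: "bounded_linear K"
    using K by (rule bounded_op_bounded_linear)
  obtain K' where K': "\<And>f g. ip (K f) g = ip f (K' g)"
    using bounded_op_adjoint[OF K] by blast
  have "has_weak_integral ip M (\<lambda>x. K (mixed_integrand f x)) (K (S f))" for f
    using has_weak_integral_mixed K' by (rule has_weak_integral_adjoint)
  then have int: "has_weak_integral ip M (\<lambda>x. (w x * v x) *\<^sub>R K (mixed_op ip H L F R G x f)) (K (S f))"
    for f
    by (simp only: linear_scale[OF bounded_linear.linear[OF K_lin]])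
  have "bounded_op smul (\<lambda>f. (w x * v x) *\<^sub>R K (mixed_op ip H L F R G x f))" if "x \<in> space M" for x
    using bounded_op_scaleR[OF bounded_op_compose[OF K bounded_op_mixed_op[OF that]]] .
  then have "resolution_of_identity smul ip M (\<lambda>x f. (w x * v x) *\<^sub>R K (mixed_op ip H L F R G x f))
    \<longleftrightarrow> (\<forall>f. has_weak_integral ip M (\<lambda>x. (w x * v x) *\<^sub>R K (mixed_op ip H L F R G x f)) f)"
    unfolding resolution_of_identity_def by blast
  also have "\<dots> \<longleftrightarrow> (\<forall>f. K (S f) = f)"
  proof (intro iffI allI)
    fix f
    show "K (S f) = f" if "\<forall>f. has_weak_integral ip M (\<lambda>x. (w x * v x) *\<^sub>R K (mixed_op ip H L F R G x f)) f"
      using int spec[OF that] by (rule has_weak_integral_unique)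
    show "has_weak_integral ip M (\<lambda>x. (w x * v x) *\<^sub>R K (mixed_op ip H L F R G x f)) f"
      if "\<forall>f. K (S f) = f"
      using int[of f] by (simp only: spec[OF that])
  qed
  finally show ?thesis .
qed

section \<open>The equivalence and the lower frame bound\<close>

lemma bounded_below_iff_resolution:
  "bounded_below S \<longleftrightarrow> (\<exists>K. bounded_op smul K \<and> resolution_of_identity smul ip M
    (\<lambda>x f. (w x * v x) *\<^sub>R K (mixed_op ip H L F R G x f)))"
proof
  assume "bounded_below S"
  then obtain K where "bounded_op smul K" "\<And>f. K (S f) = f"
    using bounded_below_left_inverse[OF bounded_op_mixed_frame_op] by blast
  then show "\<exists>K. bounded_op smul K \<and> resolution_of_identity smul ip M
    (\<lambda>x f. (w x * v x) *\<^sub>R K (mixed_op ip H L F R G x f))"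
    using resolution_iff_left_inverse by blast
next
  assume "\<exists>K. bounded_op smul K \<and> resolution_of_identity smul ip M
    (\<lambda>x f. (w x * v x) *\<^sub>R K (mixed_op ip H L F R G x f))"
  then obtain K where K: "bounded_op smul K" "\<And>f. K (S f) = f"
    using resolution_iff_left_inverse by blast
  then show "bounded_below S"
    by (rule left_inverse_bounded_below)
qed

text \<open>Testing the weak integral of \<open>S f\<close> against \<open>S f\<close> itself bounds \<open>\<parallel>S f\<parallel>\<^sup>4\<close> by
  \<open>B \<parallel>S f\<parallel>\<^sup>2\<close> times the frame integral of \<open>f\<close>.\<close>

lemma norm_mixed_frame_op_le_energy: "ennreal ((norm (S f))\<^sup>2 / B) \<le> energy f"
proof (cases "S f = 0")
  case False
  have "0 < B"
    using L by (simp add: bessel_fusion_mapping_def)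
  \<comment> \<open>The Bessel bound makes the frame integral finite, so the remaining estimate can
    be carried out in the reals.\<close>
  obtain i where i: "0 \<le> i" "energy f = ennreal i"
    using energy_le[of f] by (cases "energy f") (auto simp: top_unique)
  have "norm (ip (S f) (S f)) = (norm (S f))\<^sup>2"
    by (simp add: ip_norm norm_power)
  then have "(ennreal ((norm (S f))\<^sup>2))\<^sup>2
      \<le> (\<integral>\<^sup>+x. ennreal (norm (ip (mixed_integrand f x) (S f))) \<partial>M)\<^sup>2"
    using norm_ip_mixed_frame_op[of f "S f"] by (intro power_mono) simp_all
  also have "\<dots> \<le> energy f * ennreal (B * (norm (S f))\<^sup>2)"
    by (rule mixed_integrand_bound)
  finally have "ennreal (((norm (S f))\<^sup>2)\<^sup>2) \<le> ennreal (i * (B * (norm (S f))\<^sup>2))"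
    using i \<open>0 < B\<close> by (simp add: ennreal_power ennreal_mult)
  then have "(norm (S f))\<^sup>2 * (norm (S f))\<^sup>2 \<le> (i * B) * (norm (S f))\<^sup>2"
    using i \<open>0 < B\<close> by (simp add: ennreal_le_iff power2_eq_square[of "(norm (S f))\<^sup>2"] ac_simps)
  \<comment> \<open>Cancels one factor \<open>(norm (S f))\<^sup>2\<close>, which is positive in
    this case.\<close>
  then have "(norm (S f))\<^sup>2 \<le> i * B"
    by (rule mult_right_le_imp_le) (use False in simp)
  then show ?thesis
    using i \<open>0 < B\<close> by (simp add: ennreal_le_iff divide_le_eq)
qed simp

lemma bounded_below_imp_fusion_frame:
  assumes "bounded_below S"
  shows "fusion_frame smul ip M H R G v"
proof -
  have "0 < B"
    using L by (simp add: bessel_fusion_mapping_def)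
  obtain c where c: "c > 0" "\<And>f. c * norm f \<le> norm (S f)"
    using assms unfolding bounded_below_def by blast
  have "ennreal (c\<^sup>2 / B * (norm f)\<^sup>2) \<le> energy f" for f
  proof -
    have "(c * norm f)\<^sup>2 \<le> (norm (S f))\<^sup>2"
      using c by (intro power_mono) simp_all
    then have "c\<^sup>2 / B * (norm f)\<^sup>2 \<le> (norm (S f))\<^sup>2 / B"
      using \<open>0 < B\<close> by (simp add: power_mult_distrib divide_right_mono)
    then show ?thesis
      using norm_mixed_frame_op_le_energy by (meson ennreal_leI order_trans)
  qed
  moreover have "0 < c\<^sup>2 / B"
    using c(1) \<open>0 < B\<close> by simp
  ultimately show ?thesis
    unfolding fusion_frame_def using R by blast
qed

end

end

theorem theorem5p1:
  fixes smul :: "'s::hilbert_scalar \<Rightarrow> 'h::banach \<Rightarrow> 'h"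
    and ip :: "'h \<Rightarrow> 'h \<Rightarrow> 's"
    and M :: "'x measure"
    and H :: "'x \<Rightarrow> ('s, 'k) hilbert_struct"
    and \<Lambda> \<Gamma> :: "'x \<Rightarrow> 'h \<Rightarrow> 'k"
    and F G :: "'x \<Rightarrow> 'h set"
    and \<omega> \<nu> :: "'x \<Rightarrow> real"
    and B\<^sub>1 B\<^sub>2 :: real
  assumes "hilbert_space smul ip"
    and "\<forall>x\<in>space M. hilbert_space_on (H x)"
    and "bessel_fusion_mapping smul ip M H \<Lambda> F \<omega> B\<^sub>1"
    and "bessel_fusion_mapping smul ip M H \<Gamma> G \<nu> B\<^sub>2"
    and "\<forall>f g. (\<lambda>x. h_ip (H x) (\<Gamma> x (orth_proj ip (G x) f)) (\<Lambda> x (orth_proj ip (F x) g)))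
                  \<in> borel_measurable M"
  shows "(bounded_below (mixed_frame_op ip M H \<Lambda> F \<omega> \<Gamma> G \<nu>) \<longleftrightarrow>
            (\<exists>K. bounded_op smul K \<and> resolution_of_identity smul ip M
                   (\<lambda>x f. (\<omega> x * \<nu> x) *\<^sub>R K (mixed_op ip H \<Lambda> F \<Gamma> G x f)))) \<and>
         (bounded_below (mixed_frame_op ip M H \<Lambda> F \<omega> \<Gamma> G \<nu>) \<or>
            (\<exists>K. bounded_op smul K \<and> resolution_of_identity smul ip M
                   (\<lambda>x f. (\<omega> x * \<nu> x) *\<^sub>R K (mixed_op ip H \<Lambda> F \<Gamma> G x f)))
          \<longrightarrow> fusion_frame smul ip M H \<Gamma> G \<nu>)"
proof -
  interpret hilbert_space smul ip
    by (rule assms(1))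
  show ?thesis
    using bounded_below_iff_resolution[OF assms(2-5)] bounded_below_imp_fusion_frame[OF assms(2-5)]
    by blast
qed

end
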